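(* Assume $\mathsf{MA}(\sigma\text{-centered})$. Then every eventually different set of permutations $\mathcal P_0$ of size $<2^{\aleph_0}$ is contained in a tight eventually different set of permutations. In particular, $\mathsf{CH}$ implies that tight eventually different sets of permutations exist.
   Context: For $f,g\in\omega^\omega$, $f\neq^* g$ means there is $k<\omega$ with $f(n)\neq g(n)$ for all $n>k$. An eventually different set of permutations is a set $\mathcal P$ of bijections $\omega\to\omega$ with $f\neq^* g$ for all distinct $f,g\in\mathcal P$. A tree is a set $T\subseteq\omega^{<\omega}$ closed under initial segments and pruned (every node has a proper extension in $T$); it is injective if every $t\in T$ is an injective finite function. Functions and finite sequences are identified with their graphs; for $t\in T$ let $T_t=\{s\in T: s\subseteq t\text{ or }t\subseteq s\}$. $\mathcal I_T(\mathcal P)^+$ is the set of injective trees $T$ such that for no $t\in T$ and no finite $X\subseteq\mathcal P$ is $\bigcup T_t\setminus\bigcup X$ finite. A function $g$ densely diagonalizes a tree $T$ if for every $t\in T$ there are $s\in T$, $s\supsetneq t$, and $k\in\mathrm{dom}(s)\setminus\mathrm{dom}(t)$ with $s(k)=g(k)$. $\mathcal P$ is tight if for every countable family of injective trees $\{T_n:n<\omega\}\subseteq\mathcal I_T(\mathcal P)^+$ there is a single $g\in\mathcal P$ densely diagonalizing every $T_n$. *)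

theory Defs
  imports "HOL-Library.Equipollence" "HOL-Library.Sublist"
begin

section \<open>Eventually different sets of permutations\<close>

definition ev_diff :: "(nat \<Rightarrow> nat) \<Rightarrow> (nat \<Rightarrow> nat) \<Rightarrow> bool" where
  "ev_diff f g \<longleftrightarrow> (\<exists>k. \<forall>n>k. f n \<noteq> g n)"

definition ev_diff_perms :: "(nat \<Rightarrow> nat) set \<Rightarrow> bool" where
  "ev_diff_perms P \<longleftrightarrow> (\<forall>f\<in>P. bij f) \<and> (\<forall>f\<in>P. \<forall>g\<in>P. f \<noteq> g \<longrightarrow> ev_diff f g)"


section \<open>Trees and tightness\<close>

text \<open>
  A finite sequence of natural numbers is a list \<open>t\<close>, viewed as the function \<open>i \<mapsto> t ! i\<close>
  with domain \<open>{i. i < length t}\<close>; inclusion of finite sequences is the prefix order. The empty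
  set counts as a tree.
\<close>

definition is_tree :: "nat list set \<Rightarrow> bool" where
  "is_tree T \<longleftrightarrow> (\<forall>t\<in>T. \<forall>s. prefix s t \<longrightarrow> s \<in> T) \<and> (\<forall>t\<in>T. \<exists>s\<in>T. strict_prefix t s)"

definition inj_tree :: "nat list set \<Rightarrow> bool" where
  "inj_tree T \<longleftrightarrow> is_tree T \<and> (\<forall>t\<in>T. distinct t)"

definition seq_graph :: "nat list \<Rightarrow> (nat \<times> nat) set" where
  "seq_graph t = {(i, t ! i) | i. i < length t}"

definition fun_graph :: "(nat \<Rightarrow> nat) \<Rightarrow> (nat \<times> nat) set" where
  "fun_graph f = {(n, f n) | n. True}"

definition subtree_at :: "nat list set \<Rightarrow> nat list \<Rightarrow> nat list set" where
  "subtree_at T t = {s \<in> T. prefix s t \<or> prefix t s}"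

definition positive_trees :: "(nat \<Rightarrow> nat) set \<Rightarrow> nat list set set" where
  "positive_trees P = {T. inj_tree T \<and>
     \<not> (\<exists>t\<in>T. \<exists>X. finite X \<and> X \<subseteq> P \<and>
          finite (\<Union>(seq_graph ` subtree_at T t) - \<Union>(fun_graph ` X)))}"

definition densely_diagonalizes :: "(nat \<Rightarrow> nat) \<Rightarrow> nat list set \<Rightarrow> bool" where
  "densely_diagonalizes g T \<longleftrightarrow>
     (\<forall>t\<in>T. \<exists>s\<in>T. strict_prefix t s \<and> (\<exists>k. length t \<le> k \<and> k < length s \<and> s ! k = g k))"

definition tight :: "(nat \<Rightarrow> nat) set \<Rightarrow> bool" where
  "tight P \<longleftrightarrow> (\<forall>T :: nat \<Rightarrow> nat list set. (\<forall>n. T n \<in> positive_trees P) \<longrightarrow>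
     (\<exists>g\<in>P. \<forall>n. densely_diagonalizes g (T n)))"


section \<open>Martin's axiom for sigma-centered posets\<close>

text \<open>
  A forcing poset is a nonempty set \<open>P\<close> preordered by a relation \<open>r\<close>, where \<open>(p, q) \<in> r\<close>
  means that \<open>p\<close> is below (stronger than) \<open>q\<close>. As usual in forcing, antisymmetry is not required.
\<close>

definition centered :: "'a set \<Rightarrow> 'a rel \<Rightarrow> 'a set \<Rightarrow> bool" where
  "centered P r C \<longleftrightarrow> C \<subseteq> P \<and> (\<forall>F. finite F \<and> F \<subseteq> C \<longrightarrow> (\<exists>q\<in>P. \<forall>p\<in>F. (q, p) \<in> r))"

definition sigma_centered_poset :: "'a set \<Rightarrow> 'a rel \<Rightarrow> bool" where
  "sigma_centered_poset P r \<longleftrightarrow> P \<noteq> {} \<and> preorder_on P r \<and>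
     (\<exists>C :: nat \<Rightarrow> 'a set. P = (\<Union>n. C n) \<and> (\<forall>n. centered P r (C n)))"

definition dense_subset :: "'a set \<Rightarrow> 'a rel \<Rightarrow> 'a set \<Rightarrow> bool" where
  "dense_subset P r D \<longleftrightarrow> D \<subseteq> P \<and> (\<forall>p\<in>P. \<exists>q\<in>D. (q, p) \<in> r)"

definition filter_on :: "'a set \<Rightarrow> 'a rel \<Rightarrow> 'a set \<Rightarrow> bool" where
  "filter_on P r G \<longleftrightarrow> G \<subseteq> P \<and> G \<noteq> {} \<and>
     (\<forall>p\<in>G. \<forall>q\<in>P. (p, q) \<in> r \<longrightarrow> q \<in> G) \<and>
     (\<forall>p\<in>G. \<forall>q\<in>G. \<exists>s\<in>G. (s, p) \<in> r \<and> (s, q) \<in> r)"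

definition has_generic_filters :: "'a set \<Rightarrow> 'a rel \<Rightarrow> bool" where
  "has_generic_filters P r \<longleftrightarrow>
     (\<forall>\<D>. \<D> \<prec> (UNIV :: nat set set) \<and> (\<forall>D\<in>\<D>. dense_subset P r D) \<longrightarrow>
        (\<exists>G. filter_on P r G \<and> (\<forall>D\<in>\<D>. G \<inter> D \<noteq> {})))"

text \<open>
  A HOL proposition cannot quantify over all types, so the posets range over those whose
  underlying set consists of elements of a fixed type of cardinality continuum. This is no
  restriction: the theorem \<open>MA_sigma_centered_all_types\<close> below derives the same
  property for sigma-centered posets over an arbitrary type, of any cardinality.
\<close>

definition MA_sigma_centered :: bool where
  "MA_sigma_centered \<longleftrightarrow>
     (\<forall>(P :: nat set set) r. sigma_centered_poset P r \<longrightarrow> has_generic_filters P r)"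

definition CH :: bool where
  "CH \<longleftrightarrow> \<not> (\<exists>A :: nat set set. (UNIV :: nat set) \<prec> A \<and> A \<prec> (UNIV :: nat set set))"


subsection \<open>Independence of the choice of the type\<close>

text \<open>
  Terms for elements of the least subset of a poset that contains a base point and is closed under
  extension into each of the given dense sets, which are indexed by elements of type \<open>nat set\<close>, and
  under a choice of lower bounds of finite sets. There are only continuum many terms.
\<close>

datatype poset_term = Base | Ext "nat set" poset_term | Lower "poset_term list"

definition code_list :: "nat set list \<Rightarrow> nat set" where
  "code_list xs = insert (prod_encode (0, length xs))
     {prod_encode (Suc i, x) | i x. i < length xs \<and> x \<in> xs ! i}"

lemma inj_code_list: "code_list xs = code_list ys \<Longrightarrow> xs = ys"
proof (rule nth_equalityI)
  assume eq: "code_list xs = code_list ys"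
  have len: "prod_encode (0, n) \<in> code_list zs \<longleftrightarrow> n = length zs" for n zs
    by (auto simp: code_list_def)
  have nth: "prod_encode (Suc i, x) \<in> code_list zs \<longleftrightarrow> i < length zs \<and> x \<in> zs ! i" for i x zs
    by (auto simp: code_list_def)
  show "length xs = length ys"
    using len eq by metis
  then show "xs ! i = ys ! i" if "i < length xs" for i
    using nth[of i _ xs] nth[of i _ ys] that eq \<open>length xs = length ys\<close> by (metis subsetI subset_antisym)
qed

primrec code_term :: "poset_term \<Rightarrow> nat set" where
  "code_term Base = code_list []"
| "code_term (Ext a t) = code_list [{0}, a, code_term t]"
| "code_term (Lower ts) = code_list ({1} # map code_term ts)"

lemma inj_code_term: "code_term s = code_term t \<Longrightarrow> s = t"
proof (induction s arbitrary: t)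
  case Base
  then show ?case by (cases t) (auto dest!: inj_code_list)
next
  case (Ext a s)
  then show ?case by (cases t) (auto dest!: inj_code_list)
next
  case (Lower ss)
  show ?case
  proof (cases t)
    case (Lower ts)
    then have "map code_term ss = map code_term ts"
      using Lower.prems by (auto dest!: inj_code_list)
    then have "ss = ts"
      by (rule list.inj_map_strong[rotated]) (use Lower.IH in auto)
    then show ?thesis using Lower by simp
  qed (use Lower.prems in \<open>auto dest!: inj_code_list\<close>)
qed

theorem MA_sigma_centered_all_types:
  fixes P :: "'a set"
  assumes MA: MA_sigma_centered and P: "sigma_centered_poset P r"
  shows "has_generic_filters P r"
  unfolding has_generic_filters_def
proof (intro allI impI, elim conjE)
  fix \<D> :: "'a set set"
  assume small: "\<D> \<prec> (UNIV :: nat set set)" and dense: "\<forall>D\<in>\<D>. dense_subset P r D"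
  obtain p0 where p0: "p0 \<in> P" using P by (auto simp: sigma_centered_poset_def)
  obtain C :: "nat \<Rightarrow> 'a set" where C: "P = (\<Union>n. C n)" "\<And>n. centered P r (C n)"
    using P by (auto simp: sigma_centered_poset_def)
  have refl: "p \<in> P \<Longrightarrow> (p, p) \<in> r" for p
    using P by (auto simp: sigma_centered_poset_def preorder_on_def refl_on_def)
  have trans: "(p, q) \<in> r \<Longrightarrow> (q, s) \<in> r \<Longrightarrow> (p, s) \<in> r" for p q s
    using P by (auto simp: sigma_centered_poset_def preorder_on_def dest: transD)
  obtain idx :: "'a set \<Rightarrow> nat set" where idx: "inj_on idx \<D>"
    using small unfolding lesspoll_def lepoll_def by blast
  define ext where "ext a p = (if \<exists>D\<in>\<D>. a = idx D
      then SOME q. q \<in> inv_into \<D> idx a \<and> (q, p) \<in> r else p0)" for a p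
  define lb where "lb F = (if \<exists>q\<in>P. \<forall>p\<in>F. (q, p) \<in> r
      then SOME q. q \<in> P \<and> (\<forall>p\<in>F. (q, p) \<in> r) else p0)" for F
  have ext: "ext (idx D) p \<in> D \<and> (ext (idx D) p, p) \<in> r" if "D \<in> \<D>" "p \<in> P" for D p
  proof -
    have "\<exists>q. q \<in> D \<and> (q, p) \<in> r" using dense that unfolding dense_subset_def by blast
    from someI_ex[OF this] show ?thesis
      using that idx by (auto simp: ext_def)
  qed
  have extP: "ext a p \<in> P" if "p \<in> P" for a p
  proof (cases "\<exists>D\<in>\<D>. a = idx D")
    case True
    then show ?thesis using ext that dense by (auto simp: dense_subset_def)
  next
    case False
    then show ?thesis by (simp add: ext_def p0)
  qed
  have lb: "lb F \<in> P \<and> (\<forall>p\<in>F. (lb F, p) \<in> r)" if "\<exists>q\<in>P. \<forall>p\<in>F. (q, p) \<in> r" for F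
  proof -
    have "\<exists>q. q \<in> P \<and> (\<forall>p\<in>F. (q, p) \<in> r)" using that by blast
    from someI_ex[OF this] show ?thesis using that by (simp add: lb_def)
  qed
  have lbP: "lb F \<in> P" for F
    using lb[of F] p0 by (cases "\<exists>q\<in>P. \<forall>p\<in>F. (q, p) \<in> r") (auto simp: lb_def)
  define ev where "ev = rec_poset_term p0 (\<lambda>a t p. ext a p) (\<lambda>ts. lb (set (map snd ts)))"
  have ev [simp]: "ev Base = p0" "ev (Ext a t) = ext a (ev t)" "ev (Lower ts) = lb (ev ` set ts)"
    for a t ts by (simp_all add: ev_def image_image)
  have evP: "ev t \<in> P" for t
    by (induction t) (auto simp: p0 extP lbP)
  define Q where "Q = range code_term"
  define r' where "r' = {(code_term s, code_term t) | s t. (ev s, ev t) \<in> r}"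
  define cod where "cod A = code_term ` {t. ev t \<in> A}" for A
  have r': "(code_term s, code_term t) \<in> r' \<longleftrightarrow> (ev s, ev t) \<in> r" for s t
    by (auto simp: r'_def dest!: inj_code_term)
  have cod: "code_term t \<in> cod A \<longleftrightarrow> ev t \<in> A" for t A
    by (auto simp: cod_def dest!: inj_code_term)
  have codQ: "cod A \<subseteq> Q" for A
    by (auto simp: cod_def Q_def)
  have "preorder_on Q r'"
    unfolding preorder_on_def
  proof (intro conjI)
    show "r' \<subseteq> Q \<times> Q" by (auto simp: r'_def Q_def)
    show "refl_on Q r'" by (auto simp: refl_on_def Q_def r' refl evP)
    show "trans r'"
    proof (rule transI)
      fix x y z assume "(x, y) \<in> r'" "(y, z) \<in> r'"
      then show "(x, z) \<in> r'"
        unfolding r'_def using trans by (smt (verit) inj_code_term mem_Collect_eq prod.inject)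
    qed
  qed
  moreover have "Q = (\<Union>n. cod (C n))"
    using evP C(1) by (fastforce simp: Q_def cod_def)
  moreover have "centered Q r' (cod (C n))" for n
    unfolding centered_def
  proof (rule conjI, rule codQ, intro allI impI, elim conjE)
    fix F assume F: "finite F" "F \<subseteq> cod (C n)"
    then obtain S where S: "finite S" "S \<subseteq> {t. ev t \<in> C n}" "F = code_term ` S"
      unfolding cod_def by (meson finite_subset_image)
    obtain ts where ts: "set ts = S" using S(1) finite_list by blast
    have "finite (ev ` set ts)" "ev ` set ts \<subseteq> C n" using S ts by auto
    then have "\<exists>q\<in>P. \<forall>p\<in>ev ` set ts. (q, p) \<in> r"
      using C(2)[of n] unfolding centered_def by blast
    from lb[OF this] have "\<forall>t\<in>S. (ev (Lower ts), ev t) \<in> r" using ts by auto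
    then have "\<forall>p\<in>F. (code_term (Lower ts), p) \<in> r'" using S(3) r' by blast
    then show "\<exists>q\<in>Q. \<forall>p\<in>F. (q, p) \<in> r'" unfolding Q_def by blast
  qed
  moreover have "Q \<noteq> {}" by (simp add: Q_def)
  ultimately have "sigma_centered_poset Q r'"
    unfolding sigma_centered_poset_def by blast
  then have gen: "has_generic_filters Q r'"
    using MA by (simp add: MA_sigma_centered_def)
  have "cod ` \<D> \<prec> (UNIV :: nat set set)"
    using image_lepoll small lesspoll_trans1 by blast
  moreover have "dense_subset Q r' D'" if "D' \<in> cod ` \<D>" for D'
  proof -
    obtain D where D: "D \<in> \<D>" "D' = cod D" using \<open>D' \<in> cod ` \<D>\<close> by blast
    have "code_term (Ext (idx D) t) \<in> D' \<and> (code_term (Ext (idx D) t), code_term t) \<in> r'" for t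
      unfolding D(2) cod r' using ext[OF D(1) evP] by simp
    then show ?thesis
      using D(2) codQ by (auto simp: dense_subset_def Q_def simp del: code_term.simps)
  qed
  ultimately obtain G' where G': "filter_on Q r' G'" "\<forall>D\<in>\<D>. G' \<inter> cod D \<noteq> {}"
    using gen unfolding has_generic_filters_def by (metis (no_types, lifting) imageI)
  define G where "G = {p \<in> P. \<exists>t. code_term t \<in> G' \<and> (ev t, p) \<in> r}"
  have G'Q: "x \<in> G' \<Longrightarrow> \<exists>t. x = code_term t" for x
    using G'(1) by (auto simp: filter_on_def Q_def)
  have evG: "ev t \<in> G" if "code_term t \<in> G'" for t
    using that evP refl by (auto simp: G_def)
  have "filter_on P r G"
    unfolding filter_on_def
  proof (intro conjI ballI impI)
    show "G \<subseteq> P" by (auto simp: G_def)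
    show "G \<noteq> {}" using G'(1) G'Q evG unfolding filter_on_def by blast
    show "q \<in> G" if "p \<in> G" "q \<in> P" "(p, q) \<in> r" for p q
      using that trans by (auto simp: G_def)
    fix p q assume "p \<in> G" "q \<in> G"
    then obtain s t where st: "code_term s \<in> G'" "(ev s, p) \<in> r" "code_term t \<in> G'" "(ev t, q) \<in> r"
      by (auto simp: G_def)
    then obtain u where "code_term u \<in> G'" "(code_term u, code_term s) \<in> r'"
        "(code_term u, code_term t) \<in> r'"
      using G'(1) G'Q unfolding filter_on_def by metis
    then show "\<exists>s\<in>G. (s, p) \<in> r \<and> (s, q) \<in> r"
      using st trans evG unfolding r' by blast
  qed
  moreover have "G \<inter> D \<noteq> {}" if D: "D \<in> \<D>" for D
  proof -
    obtain t where "code_term t \<in> G'" "code_term t \<in> cod D"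
      using G'(2) D G'Q by blast
    then show ?thesis using evG by (auto simp: cod)
  qed
  ultimately show "\<exists>G. filter_on P r G \<and> (\<forall>D\<in>\<D>. G \<inter> D \<noteq> {})"
    by blast
qed

end

theory Submission
  imports Defs
begin

text \<open>
  Given an eventually different set \<open>P\<close> of fewer than continuum many permutations, force with pairs of a
  finite partial injection \<open>s\<close> and a finite \<open>F \<subseteq> P\<close>, where points added to \<open>s\<close> must avoid the graphs of
  the members of \<open>F\<close>. Conditions with the same \<open>s\<close> are compatible, so the poset is \<open>\<sigma>\<close>-centered.
  A node \<open>t\<close> of a positive tree can be extended until it is longer than all elements of the domain of
  \<open>s\<close> and decides every value in the range of \<open>s\<close>, in the sense that the value either occurs in the
  node already or occurs in no extension of it. Then, by injectivity, every point of the tree beyond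
  the node is compatible with \<open>s\<close>, and positivity yields such a point off the graphs of \<open>F\<close>. Hence a
  sufficiently generic permutation is eventually different from \<open>P\<close> and densely diagonalizes
  countably many given trees. A recursion of length continuum over all sequences of trees, which may
  visit each sequence just once since positivity with respect to a larger set is a stronger property,
  yields a tight set. Finally, \<open>CH\<close> implies Martin's axiom by the Rasiowa-Sikorski lemma.
\<close>

section \<open>Cardinals below the continuum\<close>

text \<open>By comparability of cardinals, \<prec> is the strict order of cardinal numbers. This
  makes cardinal arithmetic and initial segments of cardinal orders available for \<prec>.\<close>

lemma lesspoll_iff_ordLess: "A \<prec> B \<longleftrightarrow> (card_of A, card_of B) \<in> ordLess"
proof -
  have "A \<prec> B \<longleftrightarrow> \<not> B \<lesssim> A"
    using card_of_ordLess[of B A] card_of_ordLeq[of A B] ordLess_imp_ordLeq lepoll_antisym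
    unfolding lesspoll_def lepoll_def by (metis eqpoll_def eqpoll_imp_lepoll eqpoll_sym lepoll_def)
  then show ?thesis
    using card_of_ordLess[of B A] by (simp add: lepoll_def)
qed

lemma Un_lesspoll_infinite:
  assumes "infinite C" "A \<prec> C" "B \<prec> C"
  shows "A \<union> B \<prec> C"
  using card_of_Un_ordLess_infinite assms by (simp add: lesspoll_iff_ordLess)

lemma infinite_nat_sets: "infinite (UNIV :: nat set set)"
  by (simp add: Finite_Set.finite_set)

lemma countable_lesspoll_continuum:
  assumes "countable A"
  shows "A \<prec> (UNIV :: nat set set)"
proof -
  have "A \<lesssim> (UNIV :: nat set)"
    using assms by (auto simp: lepoll_def countable_def)
  also have "(UNIV :: nat set) \<prec> (UNIV :: nat set set)"
    using lesspoll_Pow_self[of "UNIV :: nat set"] by simp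
  finally show ?thesis .
qed

subsection \<open>Martin's axiom from the continuum hypothesis\<close>

text \<open>Rasiowa-Sikorski: a descending sequence that enters \<open>D n\<close> at step
  \<open>Suc n\<close> exists by dependent choice, and its upward closure is the filter.\<close>

lemma filter_meeting_countably_many:
  fixes P :: "'a set" and D :: "nat \<Rightarrow> 'a set"
  assumes "P \<noteq> {}" and po: "preorder_on P r" and dense: "\<And>n. dense_subset P r (D n)"
  shows "\<exists>G. filter_on P r G \<and> (\<forall>n. G \<inter> D n \<noteq> {})"
proof -
  obtain p0 where p0: "p0 \<in> P"
    using \<open>P \<noteq> {}\<close> by blast
  have refl: "p \<in> P \<Longrightarrow> (p, p) \<in> r" for p
    using po by (auto simp: preorder_on_def refl_on_def)
  have trans: "(p, q) \<in> r \<Longrightarrow> (q, s) \<in> r \<Longrightarrow> (p, s) \<in> r" for p q s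
    using po by (auto simp: preorder_on_def dest: transD)
  have "\<exists>f. \<forall>n. f n \<in> P \<and> (f (Suc n), f n) \<in> r \<and> f (Suc n) \<in> D n"
  proof (rule dependent_nat_choice)
    show "\<exists>x. x \<in> P"
      using p0 by blast
    show "\<exists>y. y \<in> P \<and> (y, x) \<in> r \<and> y \<in> D n" if "x \<in> P" for x n
      using dense[of n] that unfolding dense_subset_def by blast
  qed
  then obtain f where f: "\<And>n. f n \<in> P" "\<And>n. (f (Suc n), f n) \<in> r" "\<And>n. f (Suc n) \<in> D n"
    by blast
  have desc: "(f n, f m) \<in> r" if "m \<le> n" for m n
    using that by (induction n rule: dec_induct) (auto intro: refl f trans)
  define G where "G = {p \<in> P. \<exists>n. (f n, p) \<in> r}"
  have "filter_on P r G"
    unfolding filter_on_def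
  proof (intro conjI ballI impI)
    show "G \<subseteq> P" "G \<noteq> {}"
      using f(1)[of 0] refl by (auto simp: G_def)
    show "q \<in> G" if "p \<in> G" "q \<in> P" "(p, q) \<in> r" for p q
      using that trans by (auto simp: G_def)
    fix p q assume "p \<in> G" "q \<in> G"
    then obtain m n where "(f m, p) \<in> r" "(f n, q) \<in> r"
      by (auto simp: G_def)
    moreover have "f (max m n) \<in> G"
      using f(1) refl by (auto simp: G_def)
    ultimately show "\<exists>s\<in>G. (s, p) \<in> r \<and> (s, q) \<in> r"
      using trans desc by (metis max.cobounded1 max.cobounded2)
  qed
  moreover have "f (Suc n) \<in> G" for n
    using f(1) refl by (auto simp: G_def)
  ultimately show ?thesis
    using f(3) by blast
qed

text \<open>\<open>CH\<close> speaks of subsets of \<open>nat set\<close> only, so \<open>A\<close>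
  is first moved there by an injection \<open>h\<close>. An uncountable image would lie strictly
  between the two cardinals.\<close>

lemma CH_imp_countable:
  fixes A :: "'a set"
  assumes CH "A \<prec> (UNIV :: nat set set)"
  shows "countable A"
proof (rule ccontr)
  assume unc: "uncountable A"
  obtain h :: "'a \<Rightarrow> nat set" where h: "inj_on h A"
    using assms(2) by (auto simp: lesspoll_def lepoll_def)
  then have eq: "h ` A \<approx> A"
    by (rule inj_on_image_eqpoll_self)
  have "h ` A \<prec> (UNIV :: nat set set)"
    using eq assms(2) by (rule eq_lesspoll_trans)
  moreover have "(UNIV :: nat set) \<prec> h ` A"
  proof -
    have "uncountable (h ` A)"
      using unc h countable_image_inj_on by blast
    then have "\<not> h ` A \<lesssim> (UNIV :: nat set)"
      by (auto intro: countable_lepoll)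
    moreover have "(UNIV :: nat set) \<lesssim> h ` A"
      using \<open>uncountable (h ` A)\<close> uncountable_infinite infinite_le_lepoll by blast
    ultimately show ?thesis
      unfolding lesspoll_def using eqpoll_imp_lepoll eqpoll_sym by blast
  qed
  ultimately show False
    using \<open>CH\<close> by (auto simp: CH_def)
qed

lemma CH_imp_MA_sigma_centered:
  assumes CH
  shows MA_sigma_centered
  unfolding MA_sigma_centered_def has_generic_filters_def
proof (intro allI impI, elim conjE)
  fix P :: "nat set set" and r \<D>
  assume P: "sigma_centered_poset P r"
    and small: "\<D> \<prec> (UNIV :: nat set set)" and dense: "\<forall>D\<in>\<D>. dense_subset P r D"
  have po: "P \<noteq> {}" "preorder_on P r"
    using P by (simp_all add: sigma_centered_poset_def)
  then have denseP: "dense_subset P r P"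
    unfolding dense_subset_def preorder_on_def refl_on_def by blast
  \<comment> \<open>Adding the dense set \<open>P\<close> keeps the family nonempty, so that
    \<open>from_nat_into\<close> has exactly this family as its range.\<close>
  define D where "D = from_nat_into (insert P \<D>)"
  have range: "range D = insert P \<D>"
    unfolding D_def by (rule range_from_nat_into) (simp_all add: CH_imp_countable[OF assms small])
  have "dense_subset P r (D n)" for n
  proof -
    have "D n \<in> insert P \<D>"
      unfolding range[symmetric] by (rule rangeI)
    then show ?thesis
      using dense denseP by blast
  qed
  from filter_meeting_countably_many[of P r D, OF po this]
  obtain G where G: "filter_on P r G" "\<forall>n. G \<inter> D n \<noteq> {}"
    by blast
  have "\<forall>X\<in>range D. G \<inter> X \<noteq> {}"
    using G(2) by blast
  with G(1) show "\<exists>G. filter_on P r G \<and> (\<forall>D\<in>\<D>. G \<inter> D \<noteq> {})"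
    unfolding range by blast
qed

subsection \<open>The forcing with finite partial injections\<close>

definition partial_inj :: "(nat \<times> nat) set \<Rightarrow> bool" where
  "partial_inj s \<longleftrightarrow> finite s \<and> single_valued s \<and> single_valued (s\<inverse>)"

definition conds :: "(nat \<Rightarrow> nat) set \<Rightarrow> ((nat \<times> nat) set \<times> (nat \<Rightarrow> nat) set) set" where
  "conds P = {(s, F). partial_inj s \<and> finite F \<and> F \<subseteq> P}"

text \<open>The promise \<open>F\<close> binds only points outside \<open>s\<close>; the points
  already in \<open>s\<close> may lie on graphs of members of \<open>F\<close>. Hence
  \<open>F\<close> can be enlarged freely.\<close>

definition cond_le ::
  "(nat \<Rightarrow> nat) set \<Rightarrow> ((nat \<times> nat) set \<times> (nat \<Rightarrow> nat) set) rel" where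
  "cond_le P = {((s', F'), (s, F)). (s', F') \<in> conds P \<and> (s, F) \<in> conds P \<and>
     s \<subseteq> s' \<and> F \<subseteq> F' \<and> (\<forall>f\<in>F. \<forall>(n, m)\<in>s' - s. f n \<noteq> m)}"

text \<open>A criterion for the density of meeting \<open>A\<close>. It holds for columns, rows and
  the points above a node of a positive tree, so totality, surjectivity and diagonalization follow
  from one density lemma.\<close>

definition hittable :: "(nat \<Rightarrow> nat) set \<Rightarrow> (nat \<times> nat) set \<Rightarrow> bool" where
  "hittable P A \<longleftrightarrow> (\<forall>s F. finite s \<and> finite F \<and> F \<subseteq> P \<and> s \<inter> A = {} \<longrightarrow>
     (\<exists>(n, m)\<in>A. n \<notin> Domain s \<and> m \<notin> Range s \<and> (\<forall>f\<in>F. f n \<noteq> m)))"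

lemma hittable_column: "hittable P ({n} \<times> UNIV)"
  unfolding hittable_def
proof (intro allI impI, elim conjE)
  fix s :: "(nat \<times> nat) set" and F :: "(nat \<Rightarrow> nat) set"
  assume "finite s" "finite F" and disj: "s \<inter> {n} \<times> UNIV = {}"
  then have "finite (Range s \<union> (\<lambda>f. f n) ` F)"
    by (simp add: finite_Range)
  then obtain m where "m \<notin> Range s \<union> (\<lambda>f. f n) ` F"
    using ex_new_if_finite infinite_UNIV_nat by blast
  then show "\<exists>(n, m)\<in>{n} \<times> UNIV. n \<notin> Domain s \<and> m \<notin> Range s \<and> (\<forall>f\<in>F. f n \<noteq> m)"
    using disj by (intro bexI[of _ "(n, m)"]) auto
qed

text \<open>Injectivity leaves at most one point of the row on each graph from \<open>F\<close>, so
  only finitely many points are forbidden.\<close>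

lemma hittable_row:
  assumes "\<And>f. f \<in> P \<Longrightarrow> inj f"
  shows "hittable P (UNIV \<times> {m})"
  unfolding hittable_def
proof (intro allI impI, elim conjE)
  fix s :: "(nat \<times> nat) set" and F :: "(nat \<Rightarrow> nat) set"
  assume "finite s" "finite F" "F \<subseteq> P" and disj: "s \<inter> UNIV \<times> {m} = {}"
  have "finite (f -` {m})" if "f \<in> F" for f
    using \<open>F \<subseteq> P\<close> assms that by (intro finite_vimageI) auto
  then have "finite (Domain s \<union> (\<Union>f\<in>F. f -` {m}))"
    using \<open>finite s\<close> \<open>finite F\<close> by (simp add: finite_Domain)
  then have "\<exists>n. n \<notin> Domain s \<union> (\<Union>f\<in>F. f -` {m})"
    by (rule ex_new_if_finite[OF infinite_UNIV_nat])
  then obtain n where n: "n \<notin> Domain s" "\<forall>f\<in>F. f n \<noteq> m"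
    by blast
  moreover have "m \<notin> Range s"
    using disj by blast
  ultimately show "\<exists>(n, m)\<in>UNIV \<times> {m}. n \<notin> Domain s \<and> m \<notin> Range s \<and> (\<forall>f\<in>F. f n \<noteq> m)"
    by blast
qed

lemma partial_inj_insert:
  assumes "partial_inj s" "n \<notin> Domain s" "m \<notin> Range s"
  shows "partial_inj (insert (n, m) s)"
  using assms unfolding partial_inj_def single_valued_def by auto

lemma cond_le_refl: "p \<in> conds P \<Longrightarrow> (p, p) \<in> cond_le P"
  by (auto simp: cond_le_def)

lemma preorder_cond_le: "preorder_on (conds P) (cond_le P)"
  unfolding preorder_on_def
proof (intro conjI)
  show "cond_le P \<subseteq> conds P \<times> conds P"
    by (auto simp: cond_le_def)
  show "refl_on (conds P) (cond_le P)"
    by (auto simp: refl_on_def cond_le_def)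
  show "trans (cond_le P)"
    unfolding trans_def cond_le_def by fast
qed

text \<open>Finitely many conditions with the same stem \<open>s\<close> are bounded by
  \<open>s\<close> with the union of their promises: no point is added, so no promise can be
  violated. There are countably many stems.\<close>

lemma sigma_centered_conds: "sigma_centered_poset (conds P) (cond_le P)"
proof -
  have empty: "({}, {}) \<in> conds P"
    by (simp add: conds_def partial_inj_def)
  define C where
    "C n = {p \<in> conds P. fst p = from_nat_into {s :: (nat \<times> nat) set. finite s} n}" for n
  have "conds P = (\<Union>n. C n)"
  proof (intro equalityI subsetI)
    fix p assume p: "p \<in> conds P"
    then have "fst p \<in> {s. finite s}"
      by (auto simp: conds_def partial_inj_def)
    then obtain n where "from_nat_into {s. finite s} n = fst p"
      using from_nat_into_surj countable_Collect_finite by metis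
    then have "p \<in> C n"
      using p by (simp add: C_def)
    then show "p \<in> (\<Union>n. C n)"
      by blast
  qed (auto simp: C_def)
  moreover have "centered (conds P) (cond_le P) (C n)" for n
    unfolding centered_def
  proof (rule conjI, force simp: C_def, intro allI impI, elim conjE)
    fix X assume X: "finite X" "X \<subseteq> C n"
    show "\<exists>q\<in>conds P. \<forall>p\<in>X. (q, p) \<in> cond_le P"
    \<comment> \<open>The piece \<open>C n\<close> is empty when the \<open>n\<close>-th finite set
      is no partial injection, so the bound for empty \<open>X\<close> has to come from
      elsewhere.\<close>
    proof (cases "X = {}")
      case True
      then show ?thesis using empty by blast
    next
      case False
      then obtain s F where "(s, F) \<in> X" by auto
      with X(2) have "s = from_nat_into {s. finite s} n" "partial_inj s"
        by (auto simp: C_def conds_def)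
      then have s: "partial_inj s" "\<And>p. p \<in> X \<Longrightarrow> fst p = s" "X \<subseteq> conds P"
        using X(2) by (auto simp: C_def)
      have q: "(s, \<Union>(snd ` X)) \<in> conds P"
        using s X by (fastforce simp: conds_def)
      moreover have "((s, \<Union>(snd ` X)), p) \<in> cond_le P" if "p \<in> X" for p
        using q s(2)[OF that] s(3) that by (cases p) (auto simp: cond_le_def)
      ultimately show ?thesis by blast
    qed
  qed
  ultimately show ?thesis
    unfolding sigma_centered_poset_def using preorder_cond_le empty by blast
qed

lemma dense_hit:
  assumes "hittable P A"
  shows "dense_subset (conds P) (cond_le P) {p \<in> conds P. fst p \<inter> A \<noteq> {}}"
  unfolding dense_subset_def
proof (intro conjI ballI)
  fix p assume p: "p \<in> conds P"
  obtain s F where sF: "p = (s, F)" by fastforce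
  show "\<exists>q\<in>{p \<in> conds P. fst p \<inter> A \<noteq> {}}. (q, p) \<in> cond_le P"
  proof (cases "s \<inter> A = {}")
    case True
    then obtain n m where nm: "(n, m) \<in> A" "n \<notin> Domain s" "m \<notin> Range s" "\<And>f. f \<in> F \<Longrightarrow> f n \<noteq> m"
    proof -
      have "finite s" "finite F" "F \<subseteq> P"
        using p sF by (auto simp: conds_def partial_inj_def)
      then have "\<exists>(n, m)\<in>A. n \<notin> Domain s \<and> m \<notin> Range s \<and> (\<forall>f\<in>F. f n \<noteq> m)"
        using assms True by (simp add: hittable_def)
      then show ?thesis
        using that by force
    qed
    have "(insert (n, m) s, F) \<in> conds P"
      using p nm partial_inj_insert by (auto simp: conds_def sF)
    moreover from this have "((insert (n, m) s, F), p) \<in> cond_le P"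
      using p nm by (auto simp: cond_le_def sF)
    ultimately show ?thesis
      using nm by (intro bexI[of _ "(insert (n, m) s, F)"]) auto
  next
    case False
    then show ?thesis
      using p cond_le_refl[OF p] sF by (intro bexI[of _ p]) auto
  qed
qed auto

lemma dense_promise:
  assumes "f \<in> P"
  shows "dense_subset (conds P) (cond_le P) {p \<in> conds P. f \<in> snd p}"
  unfolding dense_subset_def
proof (intro conjI ballI)
  fix p assume p: "p \<in> conds P"
  obtain s F where sF: "p = (s, F)" by fastforce
  have "(s, insert f F) \<in> conds P"
    using p assms by (auto simp: conds_def sF)
  moreover from this have "((s, insert f F), p) \<in> cond_le P"
    using p by (auto simp: cond_le_def sF)
  ultimately show "\<exists>q\<in>{p \<in> conds P. f \<in> snd p}. (q, p) \<in> cond_le P"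
    by (intro bexI[of _ "(s, insert f F)"]) auto
qed auto

section \<open>The generic permutation\<close>

text \<open>The permutation is the union \<open>R\<close> of the stems in a generic filter. Meeting
  columns makes it total, meeting rows makes it surjective, and the promises make it eventually
  different from \<open>P\<close>.\<close>

lemma generic_permutation:
  assumes MA: MA_sigma_centered and small: "P \<prec> (UNIV :: nat set set)"
    and inj: "\<And>f. f \<in> P \<Longrightarrow> inj f"
    and count: "countable \<A>" and hit: "\<And>A. A \<in> \<A> \<Longrightarrow> hittable P A"
  shows "\<exists>g. bij g \<and> (\<forall>f\<in>P. ev_diff g f) \<and> (\<forall>A\<in>\<A>. fun_graph g \<inter> A \<noteq> {})"
proof -
  define \<B> where "\<B> = \<A> \<union> range (\<lambda>n. {n} \<times> UNIV) \<union> range (\<lambda>m. UNIV \<times> {m})"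
  define H where "H A = {p \<in> conds P. fst p \<inter> A \<noteq> {}}" for A
  define E where "E f = {p \<in> conds P. f \<in> snd p}" for f
  have hitB: "hittable P A" if "A \<in> \<B>" for A
    using that hit hittable_column hittable_row[of P] inj by (auto simp: \<B>_def)
  have "countable (H ` \<B>)"
    using count by (auto simp: \<B>_def)
  moreover have "E ` P \<prec> (UNIV :: nat set set)"
    using image_lepoll small by (rule lesspoll_trans1)
  ultimately have "H ` \<B> \<union> E ` P \<prec> (UNIV :: nat set set)"
    using Un_lesspoll_infinite[OF infinite_nat_sets] countable_lesspoll_continuum by blast
  moreover have "\<forall>D\<in>H ` \<B> \<union> E ` P. dense_subset (conds P) (cond_le P) D"
    using dense_hit dense_promise hitB by (auto simp: H_def E_def)
  ultimately obtain G where G: "filter_on (conds P) (cond_le P) G"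
      and meet: "\<forall>D\<in>H ` \<B> \<union> E ` P. G \<inter> D \<noteq> {}"
    using MA_sigma_centered_all_types[OF MA sigma_centered_conds]
    unfolding has_generic_filters_def by metis
  have meetH: "\<exists>p\<in>G. p \<in> H B" if "B \<in> \<B>" for B
    using that meet by blast
  have meetE: "\<exists>p\<in>G. p \<in> E f" if "f \<in> P" for f
    using that meet by blast
  define R where "R = \<Union>(fst ` G)"
  have GP: "p \<in> conds P" if "p \<in> G" for p
    using G that by (auto simp: filter_on_def)
  have dir: "\<exists>s\<in>G. (s, p) \<in> cond_le P \<and> (s, q) \<in> cond_le P" if "p \<in> G" "q \<in> G" for p q
    using G that by (auto simp: filter_on_def)
  have RB: "R \<inter> A \<noteq> {}" if A: "A \<in> \<B>" for A
  proof -
    obtain p where "p \<in> G" "fst p \<inter> A \<noteq> {}"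
      using meetH[OF A] unfolding H_def by blast
    then show ?thesis
      unfolding R_def by blast
  qed
  \<comment> \<open>Directedness puts any two points of \<open>R\<close> into one stem, which is a
    partial injection; so \<open>R\<close> is single-valued in both directions.\<close>
  have amalg: "\<exists>s. partial_inj s \<and> x \<in> s \<and> y \<in> s" if "x \<in> R" "y \<in> R" for x y
  proof -
    obtain p q where pq: "p \<in> G" "q \<in> G" "x \<in> fst p" "y \<in> fst q"
      using \<open>x \<in> R\<close> \<open>y \<in> R\<close> unfolding R_def by blast
    obtain u where "u \<in> G" "(u, p) \<in> cond_le P" "(u, q) \<in> cond_le P"
      using dir pq by blast
    then have "partial_inj (fst u)" "fst p \<subseteq> fst u" "fst q \<subseteq> fst u"
      by (auto simp: cond_le_def conds_def)
    then show ?thesis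
      using pq by blast
  qed
  have fn: "m = m'" if "(n, m) \<in> R" "(n, m') \<in> R" for n m m'
    using amalg[OF that] unfolding partial_inj_def single_valued_def by blast
  have fn': "n = n'" if "(n, m) \<in> R" "(n', m) \<in> R" for n n' m
    using amalg[OF that] unfolding partial_inj_def single_valued_def by blast
  have "\<exists>m. (n, m) \<in> R" for n
    using RB[of "{n} \<times> UNIV"] by (auto simp: \<B>_def)
  then obtain g where g: "\<And>n. (n, g n) \<in> R"
    by metis
  have R: "R = fun_graph g"
    using g fn by (auto simp: fun_graph_def)
  have "inj g"
  proof (rule injI)
    fix n n' assume "g n = g n'"
    then show "n = n'"
      using g[of n] g[of n'] fn' by simp
  qed
  moreover have "surj g"
  proof -
    have "\<exists>n. (n, m) \<in> R" for m
      using RB[of "UNIV \<times> {m}"] by (auto simp: \<B>_def)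
    then show ?thesis
      unfolding R fun_graph_def surj_def by auto
  qed
  moreover have "ev_diff g f" if f: "f \<in> P" for f
  proof -
    obtain p where "p \<in> G" "f \<in> snd p"
      using meetE[OF f] unfolding E_def by blast
    then obtain s F where sF: "(s, F) \<in> G" "f \<in> F"
      by (cases p) auto
    then have "finite (Domain s)"
      using GP[OF sF(1)] by (simp add: conds_def partial_inj_def finite_Domain)
    then obtain k where k: "\<forall>n\<in>Domain s. n \<le> k"
      unfolding finite_nat_set_iff_bounded_le by blast
    \<comment> \<open>Beyond the domain of \<open>s\<close> the point \<open>(n, g n)\<close> is not
      in \<open>s\<close>. A common extension \<open>u\<close> contains it as a point added below
      \<open>(s, F)\<close>, and it therefore avoids \<open>f\<close>.\<close>
    have "g n \<noteq> f n" if "n > k" for n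
    proof -
      obtain p where p: "p \<in> G" "(n, g n) \<in> fst p"
        using g[of n] by (auto simp: R_def)
      obtain u where u: "(u, p) \<in> cond_le P" "(u, (s, F)) \<in> cond_le P"
        using dir[OF p(1) sF(1)] by blast
      have "(n, g n) \<in> fst u"
        using u(1) p by (auto simp: cond_le_def)
      moreover have "(n, g n) \<notin> s"
        using k that by (meson DomainI leD)
      moreover have "\<forall>f\<in>F. \<forall>(n, m)\<in>fst u - s. f n \<noteq> m"
        using u(2) by (cases u) (simp add: cond_le_def)
      ultimately have "f n \<noteq> g n"
        using sF(2) by blast
      then show ?thesis by simp
    qed
    then show ?thesis
      by (auto simp: ev_diff_def)
  qed
  moreover have "\<forall>A\<in>\<A>. fun_graph g \<inter> A \<noteq> {}"
    using RB by (simp add: R \<B>_def)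
  ultimately show ?thesis
    by (auto simp: bij_def)
qed

subsection \<open>Positive trees\<close>

definition points_above :: "nat list set \<Rightarrow> nat list \<Rightarrow> (nat \<times> nat) set" where
  "points_above T t = {(k, s ! k) | k s. s \<in> T \<and> prefix t s \<and> length t \<le> k \<and> k < length s}"

text \<open>Reduces diagonalizing a tree to meeting one set per node, hence countably many sets. A
  position \<open>k\<close> with \<open>length t \<le> k < length s\<close> already makes
  \<open>s\<close> a proper extension of \<open>t\<close>.\<close>

lemma densely_diagonalizes_iff:
  "densely_diagonalizes g T \<longleftrightarrow> (\<forall>t\<in>T. fun_graph g \<inter> points_above T t \<noteq> {})"
proof -
  have "(\<exists>s\<in>T. strict_prefix t s \<and> (\<exists>k. length t \<le> k \<and> k < length s \<and> s ! k = g k)) \<longleftrightarrow>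
      fun_graph g \<inter> points_above T t \<noteq> {}" for t
  proof
    assume "\<exists>s\<in>T. strict_prefix t s \<and> (\<exists>k. length t \<le> k \<and> k < length s \<and> s ! k = g k)"
    then obtain s k where s: "s \<in> T" "strict_prefix t s" "length t \<le> k" "k < length s" "s ! k = g k"
      by blast
    have "(k, g k) \<in> fun_graph g"
      by (auto simp: fun_graph_def)
    moreover have "(k, g k) \<in> points_above T t"
      unfolding points_above_def using s(1,3-5) prefix_order.less_imp_le[OF s(2)] by force
    ultimately show "fun_graph g \<inter> points_above T t \<noteq> {}"
      by blast
  next
    assume "fun_graph g \<inter> points_above T t \<noteq> {}"
    then obtain k s where s: "s \<in> T" "prefix t s" "length t \<le> k" "k < length s" "s ! k = g k"
      unfolding fun_graph_def points_above_def by auto metis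
    then have "strict_prefix t s"
      by (auto simp: strict_prefix_def)
    then show "\<exists>s\<in>T. strict_prefix t s \<and> (\<exists>k. length t \<le> k \<and> k < length s \<and> s ! k = g k)"
      using s by blast
  qed
  then show ?thesis
    by (simp add: densely_diagonalizes_def)
qed

lemma tree_extend_length:
  assumes "is_tree T" "t \<in> T"
  shows "\<exists>u\<in>T. prefix t u \<and> N \<le> length u"
proof (induction N)
  case 0
  then show ?case using assms by auto
next
  case (Suc N)
  then obtain u where u: "u \<in> T" "prefix t u" "N \<le> length u"
    by blast
  then obtain v where "v \<in> T" "strict_prefix u v"
    using assms by (auto simp: is_tree_def)
  then show ?case
    using u by (metis Suc_leI le_trans not_less_eq_eq prefix_length_less prefix_order.less_imp_le
        prefix_order.trans)
qed

text \<open>The values are treated one by one: move to an extension containing \<open>m\<close> if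
  there is one; otherwise the present node already excludes \<open>m\<close>.\<close>

lemma tree_decide_values:
  assumes "finite M" "t \<in> T"
  shows "\<exists>u\<in>T. prefix t u \<and> (\<forall>m\<in>M. m \<in> set u \<or> (\<forall>v\<in>T. prefix u v \<longrightarrow> m \<notin> set v))"
  using assms(1)
proof induction
  case empty
  then show ?case using assms(2) by auto
next
  case (insert m M)
  define decided where
    "decided u x \<longleftrightarrow> x \<in> set u \<or> (\<forall>v\<in>T. prefix u v \<longrightarrow> x \<notin> set v)" for u x
  obtain u where u: "u \<in> T" "prefix t u" "\<forall>x\<in>M. decided u x"
    using insert.IH by (auto simp: decided_def)
  \<comment> \<open>Decisions persist in extensions, so treating \<open>m\<close> does not spoil the
    values treated before.\<close>
  have mono: "decided v x" if "decided u x" "prefix u v" for v x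
    using that set_mono_prefix[of u v] prefix_order.trans[of u v]
    unfolding decided_def by blast
  obtain v where v: "v \<in> T" "prefix u v" "decided v m"
  proof (cases "\<exists>v\<in>T. prefix u v \<and> m \<in> set v")
    case True
    then show ?thesis using that by (auto simp: decided_def)
  next
    case False
    then have "decided u m" by (auto simp: decided_def)
    then show ?thesis using that u(1) by blast
  qed
  have "prefix t v"
    using u(2) v(2) by (rule prefix_order.trans)
  moreover have "\<forall>x\<in>insert m M. decided v x"
    using u(3) v(2,3) mono by blast
  ultimately show ?case
    using v(1) unfolding decided_def by blast
qed

lemma hittable_points_above:
  assumes T: "T \<in> positive_trees P" and t: "t \<in> T"
  shows "hittable P (points_above T t)"
  unfolding hittable_def
proof (intro allI impI, elim conjE)
  fix s :: "(nat \<times> nat) set" and F :: "(nat \<Rightarrow> nat) set"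
  assume s: "finite s" and F: "finite F" "F \<subseteq> P"
  have tree: "is_tree T" and inj: "\<And>u. u \<in> T \<Longrightarrow> distinct u"
    using T by (auto simp: positive_trees_def inj_tree_def)
  obtain N where N: "\<And>n. n \<in> Domain s \<Longrightarrow> n < N"
    using s finite_nat_set_iff_bounded by (metis finite_Domain)
  obtain t1 where t1: "t1 \<in> T" "prefix t t1" "N \<le> length t1"
    using tree_extend_length[OF tree t] by blast
  obtain u where u: "u \<in> T" "prefix t1 u"
      and dec: "\<And>m. m \<in> Range s \<Longrightarrow> m \<in> set u \<or> (\<forall>v\<in>T. prefix u v \<longrightarrow> m \<notin> set v)"
    using tree_decide_values[OF finite_Range[OF s] t1(1)] by blast
  have "infinite (\<Union>(seq_graph ` subtree_at T u) - \<Union>(fun_graph ` F))"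
  proof -
    have "\<not> (\<exists>t\<in>T. \<exists>X. finite X \<and> X \<subseteq> P \<and>
        finite (\<Union>(seq_graph ` subtree_at T t) - \<Union>(fun_graph ` X)))"
      using T unfolding positive_trees_def by simp
    then show ?thesis
      using u(1) F by meson
  qed
  moreover have "finite (seq_graph u)"
    by (simp add: seq_graph_def)
  \<comment> \<open>Discarding the finite graph of \<open>u\<close> itself leaves only points at
    positions beyond \<open>u\<close>.\<close>
  ultimately have "infinite (\<Union>(seq_graph ` subtree_at T u) - \<Union>(fun_graph ` F) - seq_graph u)"
    by (rule Diff_infinite_finite[rotated])
  from infinite_imp_nonempty[OF this]
  obtain x where "x \<in> \<Union>(seq_graph ` subtree_at T u) - \<Union>(fun_graph ` F) - seq_graph u"
    by (auto simp only: ex_in_conv[symmetric])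
  then obtain k m where km: "(k, m) \<in> \<Union>(seq_graph ` subtree_at T u)"
      "(k, m) \<notin> \<Union>(fun_graph ` F)" "(k, m) \<notin> seq_graph u"
    by (cases x) auto
  obtain v where v: "v \<in> T" "prefix v u \<or> prefix u v" "k < length v" "m = v ! k"
    using km(1) by (auto simp: subtree_at_def seq_graph_def)
  have off: "\<not> (k < length u \<and> u ! k = m)"
    using km(3) by (auto simp: seq_graph_def)
  \<comment> \<open>\<open>subtree_at\<close> also contains the initial segments of
    \<open>u\<close>, but their points belong to the discarded graph.\<close>
  have uv: "prefix u v"
    using v(2)
  proof
    assume "prefix v u"
    then have "k < length u \<and> u ! k = m"
      using v(3,4) by (auto simp: prefix_def nth_append)
    with off show ?thesis ..
  qed
  then have "v ! k = u ! k" if "k < length u"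
    using that by (auto simp: prefix_def nth_append)
  then have k: "length u \<le> k"
    using off v(4) not_less by metis
  have "length t1 \<le> length u"
    using u(2) by (rule prefix_length_le)
  moreover have "length t \<le> length t1"
    using t1(2) by (rule prefix_length_le)
  moreover have "prefix t v"
    using prefix_order.trans[OF prefix_order.trans[OF t1(2) u(2)] uv] .
  ultimately have "(k, m) \<in> points_above T t"
    using v k by (auto simp: points_above_def)
  moreover have "k \<notin> Domain s"
    using N[of k] t1(3) k \<open>length t1 \<le> length u\<close> by linarith
  \<comment> \<open>A value in \<open>Range s\<close> that occurs in \<open>v\<close> was decided
    positively, so it occurs in \<open>u\<close> at some \<open>i < length u \<le> k\<close>. Then
    \<open>v\<close> would repeat it at position \<open>k\<close>.\<close>
  moreover have "m \<notin> Range s"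
  proof
    assume "m \<in> Range s"
    then have "m \<in> set u"
      using dec[of m] v uv by auto
    then obtain i where i: "i < length u" "u ! i = m"
      by (auto simp: in_set_conv_nth)
    then have "v ! i = v ! k"
      using uv v by (auto simp: prefix_def nth_append)
    then have "i = k"
      using inj[OF v(1)] i v(3) k by (auto simp: nth_eq_iff_index_eq)
    then show False
      using i k by simp
  qed
  moreover have "\<forall>f\<in>F. f k \<noteq> m"
    using km(2) by (auto simp: fun_graph_def)
  ultimately show "\<exists>(n, m)\<in>points_above T t. n \<notin> Domain s \<and> m \<notin> Range s \<and> (\<forall>f\<in>F. f n \<noteq> m)"
    by blast
qed

lemma positive_trees_antimono: "P \<subseteq> Q \<Longrightarrow> positive_trees Q \<subseteq> positive_trees P"
  unfolding positive_trees_def by blast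

lemma empty_positive_tree: "{} \<in> positive_trees P"
  by (simp add: positive_trees_def inj_tree_def is_tree_def)

lemma diagonalizing_permutation:
  fixes T :: "nat \<Rightarrow> nat list set"
  assumes MA_sigma_centered "P \<prec> (UNIV :: nat set set)" "\<And>f. f \<in> P \<Longrightarrow> bij f"
    and T: "\<And>n. T n \<in> positive_trees P"
  shows "\<exists>g. bij g \<and> (\<forall>f\<in>P. ev_diff g f) \<and> (\<forall>n. densely_diagonalizes g (T n))"
proof -
  define \<A> where "\<A> = (\<Union>n. points_above (T n) ` T n)"
  have "countable \<A>"
    by (simp add: \<A>_def)
  moreover have "hittable P A" if "A \<in> \<A>" for A
    using that hittable_points_above T by (auto simp: \<A>_def)
  ultimately obtain g where "bij g" "\<forall>f\<in>P. ev_diff g f" "\<forall>A\<in>\<A>. fun_graph g \<inter> A \<noteq> {}"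
    using generic_permutation[of P \<A>] assms bij_is_inj by blast
  then show ?thesis
    unfolding densely_diagonalizes_iff \<A>_def by blast
qed

subsection \<open>The recursion\<close>

lemma ev_diff_sym: "ev_diff f g \<longleftrightarrow> ev_diff g f"
  by (metis ev_diff_def)

text \<open>A sequence of sets of lists is a subset of the countably infinite type
  \<open>nat \<times> nat list\<close>.\<close>

lemma tree_sequences_eqpoll_continuum:
  "(UNIV :: (nat \<Rightarrow> nat list set) set) \<approx> (UNIV :: nat set set)"
proof -
  obtain b :: "nat \<times> nat list \<Rightarrow> nat" where b: "bij b"
  proof -
    have "infinite (UNIV :: (nat \<times> nat list) set)"
      by (simp add: finite_prod)
    then show ?thesis
      using that to_nat_on_infinite[of "UNIV :: (nat \<times> nat list) set"] by auto
  qed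
  have "bij (\<lambda>T. {(n, t). t \<in> (T :: nat \<Rightarrow> nat list set) n})"
    by (rule o_bij[of "\<lambda>X n. {t. (n, t) \<in> X}"]) (auto simp: fun_eq_iff)
  moreover have "bij ((`) b)"
    by (rule o_bij[of "(`) (inv b)"])
      (use b in \<open>auto simp: fun_eq_iff image_image bij_is_inj bij_is_surj surj_f_inv_f\<close>)
  ultimately have "bij ((`) b \<circ> (\<lambda>T. {(n, t). t \<in> (T :: nat \<Rightarrow> nat list set) n}))"
    by (rule bij_comp)
  then show ?thesis
    unfolding eqpoll_def by blast
qed

text \<open>The strict part of the cardinal order on all sequences: its proper initial segments are
  smaller than the whole, that is, than the continuum.\<close>

lemma continuum_well_order:
  "\<exists>W :: (nat \<Rightarrow> nat list set) rel. wf W \<and> trans W \<and> total W \<and>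
     (\<forall>x. {y. (y, x) \<in> W} \<prec> (UNIV :: nat set set))"
proof -
  let ?r = "card_of (UNIV :: (nat \<Rightarrow> nat list set) set)"
  have wo: "Well_order ?r" and field: "Field ?r = UNIV"
    using card_of_Well_order by (simp_all only: Field_card_of)
  have "{y. (y, x) \<in> ?r - Id} \<prec> (UNIV :: nat set set)" for x
  proof -
    have "(card_of (underS ?r x), ?r) \<in> ordLess"
      by (rule card_of_underS[OF card_of_Card_order]) (simp only: Field_card_of UNIV_I)
    then have "underS ?r x \<prec> (UNIV :: (nat \<Rightarrow> nat list set) set)"
      by (simp add: lesspoll_iff_ordLess)
    then have "underS ?r x \<prec> (UNIV :: nat set set)"
      using tree_sequences_eqpoll_continuum by (rule lesspoll_eq_trans)
    moreover have "underS ?r x = {y. (y, x) \<in> ?r - Id}"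
      by (auto simp: underS_def)
    ultimately show ?thesis by simp
  qed
  moreover have "wf (?r - Id)" "total (?r - Id)" "trans (?r - Id)"
    using wo field unfolding well_order_on_def linear_order_on_def partial_order_on_def preorder_on_def
    by (auto simp: trans_diff_Id)
  ultimately show ?thesis
    by blast
qed

lemma extend_to_tight:
  assumes MA: MA_sigma_centered and P0: "ev_diff_perms P0" "P0 \<prec> (UNIV :: nat set set)"
  shows "\<exists>P. P0 \<subseteq> P \<and> ev_diff_perms P \<and> tight P"
proof -
  obtain W :: "(nat \<Rightarrow> nat list set) rel" where W: "wf W" "trans W" "total W"
      and small: "\<And>x. {y. (y, x) \<in> W} \<prec> (UNIV :: nat set set)"
    using continuum_well_order by blast
  \<comment> \<open>\<open>S f x\<close> is the set built before stage \<open>x\<close>. In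
    \<open>good\<close>, positivity is only a premise of the diagonalization, so every stage yields
    a permutation, whether or not its sequence is positive.\<close>
  define S where "S f x = P0 \<union> f ` {y. (y, x) \<in> W}" for f x
  define good where "good f T g \<longleftrightarrow> bij g \<and> (\<forall>p\<in>S f T. ev_diff g p) \<and>
    ((\<forall>n. T n \<in> positive_trees (S f T)) \<longrightarrow> (\<forall>n. densely_diagonalizes g (T n)))" for f T g
  have "\<exists>f :: (nat \<Rightarrow> nat list set) \<Rightarrow> nat \<Rightarrow> nat. \<forall>T. good f T (f T)"
  proof (rule dependent_wf_choice[OF W(1)])
    fix f f' :: "(nat \<Rightarrow> nat list set) \<Rightarrow> nat \<Rightarrow> nat" and T g
    assume "\<And>y. (y, T) \<in> W \<Longrightarrow> f y = f' y"
    then have "S f T = S f' T"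
      by (auto simp: S_def)
    then show "good f T g = good f' T g"
      by (simp add: good_def)
  next
    fix T and f :: "(nat \<Rightarrow> nat list set) \<Rightarrow> nat \<Rightarrow> nat"
    assume IH: "\<And>y. (y, T) \<in> W \<Longrightarrow> good f y (f y)"
    have "f ` {y. (y, T) \<in> W} \<prec> (UNIV :: nat set set)"
      using image_lepoll small by (rule lesspoll_trans1)
    then have 1: "S f T \<prec> (UNIV :: nat set set)"
      unfolding S_def using P0(2) by (intro Un_lesspoll_infinite infinite_nat_sets)
    have 2: "bij p" if "p \<in> S f T" for p
      using that IH P0(1) by (auto simp: S_def good_def ev_diff_perms_def)
    \<comment> \<open>When \<open>T\<close> is not positive, empty trees replace it, because they
      are positive for every set.\<close>
    define T' where "T' = (if \<forall>n. T n \<in> positive_trees (S f T) then T else (\<lambda>_. {}))"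
    have "T' n \<in> positive_trees (S f T)" for n
      by (simp add: T'_def empty_positive_tree)
    then show "\<exists>g. good f T g"
      using diagonalizing_permutation[OF MA 1 2, of T'] unfolding good_def T'_def by auto
  qed
  then obtain f where f: "\<And>T. good f T (f T)"
    by blast
  define P where "P = P0 \<union> range f"
  have new_old: "ev_diff (f T) p" if "p \<in> P0" for T p
    using f[of T] that by (auto simp: good_def S_def)
  have new_new: "ev_diff (f T) (f T')" if "f T \<noteq> f T'" for T T'
  proof -
    \<comment> \<open>The later of the two was chosen eventually different from everything before
      it.\<close>
    have less: "ev_diff (f T) (f T')" if "(T', T) \<in> W" for T T'
      using f[of T] that by (auto simp: good_def S_def)
    have "(T, T') \<in> W \<or> (T', T) \<in> W"
      using \<open>f T \<noteq> f T'\<close> W(3) by (metis UNIV_I total_on_def)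
    then show ?thesis
      using less ev_diff_sym by blast
  qed
  have "ev_diff_perms P"
    using P0(1) new_old new_new f ev_diff_sym by (auto simp: ev_diff_perms_def P_def good_def)
  moreover have "tight P"
    unfolding tight_def
  proof (intro allI impI)
    fix T :: "nat \<Rightarrow> nat list set"
    assume "\<forall>n. T n \<in> positive_trees P"
    \<comment> \<open>The sequence \<open>T\<close> is itself a stage. Positivity for
      \<open>P\<close> passes down to the part built before it, so \<open>f T\<close> diagonalizes
      all of \<open>T\<close>.\<close>
    moreover have "S f T \<subseteq> P"
      by (auto simp: S_def P_def)
    ultimately have "\<forall>n. T n \<in> positive_trees (S f T)"
      using positive_trees_antimono by blast
    then have "\<forall>n. densely_diagonalizes (f T) (T n)"
      using f[of T] by (simp add: good_def)
    then show "\<exists>g\<in>P. \<forall>n. densely_diagonalizes g (T n)"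
      by (auto simp: P_def)
  qed
  ultimately show ?thesis
    by (auto simp: P_def)
qed

theorem theorem5p4:
  shows "(MA_sigma_centered \<longrightarrow>
           (\<forall>P0 :: (nat \<Rightarrow> nat) set.
              ev_diff_perms P0 \<and> P0 \<prec> (UNIV :: nat set set) \<longrightarrow>
              (\<exists>P. P0 \<subseteq> P \<and> ev_diff_perms P \<and> tight P)))
       \<and> (CH \<longrightarrow> (\<exists>P. ev_diff_perms P \<and> tight P))"
proof (intro conjI impI allI)
  fix P0 :: "(nat \<Rightarrow> nat) set"
  assume MA_sigma_centered "ev_diff_perms P0 \<and> P0 \<prec> (UNIV :: nat set set)"
  then show "\<exists>P. P0 \<subseteq> P \<and> ev_diff_perms P \<and> tight P"
    using extend_to_tight by blast
next
  assume CH
  have "ev_diff_perms {}"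
    by (simp add: ev_diff_perms_def)
  moreover have "({} :: (nat \<Rightarrow> nat) set) \<prec> (UNIV :: nat set set)"
    by (rule countable_lesspoll_continuum) simp
  ultimately show "\<exists>P. ev_diff_perms P \<and> tight P"
    using extend_to_tight[OF CH_imp_MA_sigma_centered[OF \<open>CH\<close>]] by blast
qed

end
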